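(* Let $G$ be a solid branchwise commutative weak BCC-algebra and let $p\in G$. Then the set $A(p)=\{x\in G: x\leqslant p\}$ is a distributive lattice with respect to the operations $x\wedge y=y(yx)$ and $x\vee_p y=p\big((px)\wedge(py)\big)$, where likewise $(px)\wedge(py)=(py)\big((py)(px)\big)$.
   Context: The operation is written by juxtaposition. A weak BCC-algebra is a set $G$ with a binary operation and a constant $0$ such that for all $x,y,z\in G$: $((xy)(zy))(xz)=0$; $xx=0$; $x0=x$; and $xy=yx=0$ implies $x=y$. Its natural partial order is $x\leqslant y\iff xy=0$. $I(G)$ denotes the set of minimal elements of $(G,\leqslant)$; for $a\in I(G)$ the branch initiated by $a$ is $B(a)=\{x\in G: a\leqslant x\}$. Elements $x,y$ are in the same branch if $x,y\in B(a)$ for some $a\in I(G)$. $G$ is solid if $(xy)z=(xz)y$ for all $x,y$ belonging to the same branch and all $z\in G$. $G$ is branchwise commutative if $x(xy)=y(yx)$ for all $x,y$ belonging to the same branch. *)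

theory Defs
  imports Main
begin

locale weak_BCC_algebra =
  fixes G :: "'a set"
    and mult :: "'a \<Rightarrow> 'a \<Rightarrow> 'a"  (infixl "\<cdot>" 70)
    and zero :: 'a  ("\<zero>")
  assumes mult_closed: "\<lbrakk>x \<in> G; y \<in> G\<rbrakk> \<Longrightarrow> x \<cdot> y \<in> G"
    and zero_closed: "\<zero> \<in> G"
    and BCC: "\<lbrakk>x \<in> G; y \<in> G; z \<in> G\<rbrakk> \<Longrightarrow> ((x \<cdot> y) \<cdot> (z \<cdot> y)) \<cdot> (x \<cdot> z) = \<zero>"
    and mult_self: "x \<in> G \<Longrightarrow> x \<cdot> x = \<zero>"
    and mult_zero: "x \<in> G \<Longrightarrow> x \<cdot> \<zero> = x"
    and mult_antisym: "\<lbrakk>x \<in> G; y \<in> G; x \<cdot> y = \<zero>; y \<cdot> x = \<zero>\<rbrakk> \<Longrightarrow> x = y"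
begin

definition le :: "'a \<Rightarrow> 'a \<Rightarrow> bool"  (infix "\<preceq>" 50)
  where "x \<preceq> y \<longleftrightarrow> x \<cdot> y = \<zero>"

definition minimal_elements :: "'a set"
  where "minimal_elements = {a \<in> G. \<forall>x\<in>G. x \<preceq> a \<longrightarrow> x = a}"

definition branch :: "'a \<Rightarrow> 'a set"
  where "branch a = {x \<in> G. a \<preceq> x}"

definition same_branch :: "'a \<Rightarrow> 'a \<Rightarrow> bool"
  where "same_branch x y \<longleftrightarrow> (\<exists>a\<in>minimal_elements. x \<in> branch a \<and> y \<in> branch a)"

definition solid :: bool
  where "solid \<longleftrightarrow>
    (\<forall>x\<in>G. \<forall>y\<in>G. \<forall>z\<in>G. same_branch x y \<longrightarrow> (x \<cdot> y) \<cdot> z = (x \<cdot> z) \<cdot> y)"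

definition branchwise_commutative :: bool
  where "branchwise_commutative \<longleftrightarrow>
    (\<forall>x\<in>G. \<forall>y\<in>G. same_branch x y \<longrightarrow> x \<cdot> (x \<cdot> y) = y \<cdot> (y \<cdot> x))"

definition initial_segment :: "'a \<Rightarrow> 'a set"
  where "initial_segment p = {x \<in> G. x \<preceq> p}"

definition meet :: "'a \<Rightarrow> 'a \<Rightarrow> 'a"  (infixl "\<sqinter>" 70)
  where "x \<sqinter> y = y \<cdot> (y \<cdot> x)"

definition join_below :: "'a \<Rightarrow> 'a \<Rightarrow> 'a \<Rightarrow> 'a"
  where "join_below p x y = p \<cdot> ((p \<cdot> x) \<sqinter> (p \<cdot> y))"

end

text \<open>Distributive lattices in the algebraic sense on a carrier set. Idempotence and the
  dual distributive law are consequences of the axioms below.\<close>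

locale distributive_lattice_on =
  fixes L :: "'a set"
    and inf :: "'a \<Rightarrow> 'a \<Rightarrow> 'a"  (infixl "\<^bold>\<and>" 70)
    and sup :: "'a \<Rightarrow> 'a \<Rightarrow> 'a"  (infixl "\<^bold>\<or>" 65)
  assumes inf_closed: "\<lbrakk>x \<in> L; y \<in> L\<rbrakk> \<Longrightarrow> x \<^bold>\<and> y \<in> L"
    and sup_closed: "\<lbrakk>x \<in> L; y \<in> L\<rbrakk> \<Longrightarrow> x \<^bold>\<or> y \<in> L"
    and inf_commute: "\<lbrakk>x \<in> L; y \<in> L\<rbrakk> \<Longrightarrow> x \<^bold>\<and> y = y \<^bold>\<and> x"
    and sup_commute: "\<lbrakk>x \<in> L; y \<in> L\<rbrakk> \<Longrightarrow> x \<^bold>\<or> y = y \<^bold>\<or> x"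
    and inf_assoc: "\<lbrakk>x \<in> L; y \<in> L; z \<in> L\<rbrakk> \<Longrightarrow> (x \<^bold>\<and> y) \<^bold>\<and> z = x \<^bold>\<and> (y \<^bold>\<and> z)"
    and sup_assoc: "\<lbrakk>x \<in> L; y \<in> L; z \<in> L\<rbrakk> \<Longrightarrow> (x \<^bold>\<or> y) \<^bold>\<or> z = x \<^bold>\<or> (y \<^bold>\<or> z)"
    and inf_sup_absorb: "\<lbrakk>x \<in> L; y \<in> L\<rbrakk> \<Longrightarrow> x \<^bold>\<and> (x \<^bold>\<or> y) = x"
    and sup_inf_absorb: "\<lbrakk>x \<in> L; y \<in> L\<rbrakk> \<Longrightarrow> x \<^bold>\<or> (x \<^bold>\<and> y) = x"
    and inf_sup_distrib:
      "\<lbrakk>x \<in> L; y \<in> L; z \<in> L\<rbrakk> \<Longrightarrow> x \<^bold>\<and> (y \<^bold>\<or> z) = (x \<^bold>\<and> y) \<^bold>\<or> (x \<^bold>\<and> z)"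

end

theory Submission
  imports Defs
begin

text \<open>
  For every \<open>p\<close> the element \<open>a = \<zero>(\<zero>p)\<close> is minimal and lies below every \<open>x \<preceq> p\<close>, so \<open>A(p)\<close> is
  contained in the single branch \<open>B(a)\<close>, where the exchange law \<open>(xy)z = (xz)y\<close> and the
  commutative law \<open>x(xy) = y(yx)\<close> are available. All products of two elements of \<open>A(p)\<close> lie in
  \<open>B(\<zero>)\<close>, which is a commutative BCK-algebra.

  By commutativity \<open>y(yx)\<close> is the infimum of \<open>x\<close> and \<open>y\<close> in each branch, and \<open>y(yx) = x\<close> if
  \<open>x \<preceq> y\<close>. Hence \<open>x \<mapsto> px\<close> is an injective order-reversing map from \<open>A(p)\<close> into \<open>B(\<zero>)\<close> with left inverse
  \<open>u \<mapsto> pu\<close>, which makes \<open>p(px \<sqinter> py)\<close> the supremum of \<open>x\<close> and \<open>y\<close> in \<open>A(p)\<close>.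

  Distributivity is where a common upper bound matters, as infima in \<open>B(\<zero>)\<close> alone need not
  satisfy \<open>ac \<sqinter> bc \<preceq> (a \<sqinter> b)c\<close>. If \<open>a\<close> and \<open>b\<close> have an upper bound, then right cancellation
  holds below it (\<open>mult_right_cancel\<close>) and the inequality follows (\<open>le_meet_mult\<close>). It applies to
  \<open>px\<close> and \<open>py\<close>, which are bounded by \<open>pa\<close>; as \<open>zx = (px)(pz)\<close> on \<open>A(p)\<close>, it says that a lower
  bound of \<open>zx\<close> and \<open>zy\<close> in \<open>B(\<zero>)\<close> lies below \<open>z(x \<or> y)\<close> (\<open>le_mult_join_below\<close>). Taking
  the lower bound \<open>zs\<close> with \<open>s = (z \<sqinter> x) \<or> (z \<sqinter> y)\<close> and multiplying from the left by \<open>z\<close> yields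
  \<open>z \<sqinter> (x \<or> y) \<preceq> s\<close>.
\<close>

section \<open>Order and branches in a weak BCC-algebra\<close>

context weak_BCC_algebra
begin

lemma le_refl: "x \<in> G \<Longrightarrow> x \<preceq> x"
  by (simp add: le_def mult_self)

lemma le_antisym: "\<lbrakk>x \<in> G; y \<in> G; x \<preceq> y; y \<preceq> x\<rbrakk> \<Longrightarrow> x = y"
  by (simp add: le_def mult_antisym)

lemma le_trans:
  assumes "x \<in> G" "y \<in> G" "z \<in> G" "x \<preceq> y" "y \<preceq> z"
  shows "x \<preceq> z"
  using BCC[of x z y] assms by (simp add: le_def mult_zero mult_closed)

lemma mult_right_mono:
  assumes "x \<in> G" "y \<in> G" "z \<in> G" "x \<preceq> y"
  shows "x \<cdot> z \<preceq> y \<cdot> z"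
  using BCC[of x z y] assms by (simp add: le_def mult_zero mult_closed)

lemma mult_left_antimono:
  assumes "x \<in> G" "y \<in> G" "z \<in> G" "x \<preceq> y"
  shows "z \<cdot> y \<preceq> z \<cdot> x"
  using BCC[of z y x] assms by (simp add: le_def mult_zero mult_closed)

text \<open>Although \<open>\<zero>(\<zero>p)\<close> is defined from \<open>p\<close> alone, it bounds everything below \<open>p\<close> from below;
  this is what puts all of \<open>A(p)\<close> into a single branch.\<close>

lemma zero_zero_mult_le_of_le:
  assumes "x \<in> G" "p \<in> G" "x \<preceq> p"
  shows "\<zero> \<cdot> (\<zero> \<cdot> p) \<preceq> x"
  using BCC[of x p \<zero>] assms by (simp add: le_def mult_zero zero_closed)

lemma zero_triple:
  assumes "z \<in> G"
  shows "\<zero> \<cdot> (\<zero> \<cdot> (\<zero> \<cdot> z)) = \<zero> \<cdot> z"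
proof (rule le_antisym)
  have le: "\<zero> \<cdot> (\<zero> \<cdot> z) \<preceq> z"
    using zero_zero_mult_le_of_le assms le_refl by blast
  show "\<zero> \<cdot> (\<zero> \<cdot> (\<zero> \<cdot> z)) \<preceq> \<zero> \<cdot> z"
    using zero_zero_mult_le_of_le assms le_refl mult_closed zero_closed by blast
  show "\<zero> \<cdot> z \<preceq> \<zero> \<cdot> (\<zero> \<cdot> (\<zero> \<cdot> z))"
    using mult_left_antimono le assms by (simp add: mult_closed zero_closed)
qed (use assms in \<open>simp_all add: mult_closed zero_closed\<close>)

lemma zero_zero_mult_minimal:
  assumes "x \<in> G"
  shows "\<zero> \<cdot> (\<zero> \<cdot> x) \<in> minimal_elements"
  unfolding minimal_elements_def
proof (safe)
  show "\<zero> \<cdot> (\<zero> \<cdot> x) \<in> G"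
    using assms by (simp add: mult_closed zero_closed)
  fix y assume y: "y \<in> G" "y \<preceq> \<zero> \<cdot> (\<zero> \<cdot> x)"
  have "\<zero> \<cdot> (\<zero> \<cdot> x) \<preceq> y"
    using zero_zero_mult_le_of_le[OF y(1) _ y(2)] zero_triple[of "\<zero> \<cdot> x"] assms
    by (simp add: mult_closed zero_closed)
  then show "y = \<zero> \<cdot> (\<zero> \<cdot> x)"
    using le_antisym y assms by (simp add: mult_closed zero_closed)
qed

lemma same_branch_of_upper_bound:
  assumes "x \<in> G" "y \<in> G" "p \<in> G" "x \<preceq> p" "y \<preceq> p"
  shows "same_branch x y"
proof -
  have "\<zero> \<cdot> (\<zero> \<cdot> p) \<preceq> x" "\<zero> \<cdot> (\<zero> \<cdot> p) \<preceq> y"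
    using assms zero_zero_mult_le_of_le by blast+
  then show ?thesis
    using zero_zero_mult_minimal[of p] assms unfolding same_branch_def branch_def by auto
qed

lemma zero_le_mult_of_same_branch:
  assumes "same_branch x y"
  shows "\<zero> \<preceq> x \<cdot> y"
proof -
  obtain a where a: "a \<in> G" "a \<preceq> x" "a \<preceq> y" "x \<in> G" "y \<in> G"
    using assms by (auto simp: same_branch_def branch_def minimal_elements_def)
  then show ?thesis
    using mult_right_mono[of a x y] by (simp add: le_def)
qed

lemma same_branch_sym: "same_branch x y \<Longrightarrow> same_branch y x"
  by (auto simp: same_branch_def)

lemma same_branch_of_le: "\<lbrakk>x \<in> G; y \<in> G; x \<preceq> y\<rbrakk> \<Longrightarrow> same_branch x y"
  using same_branch_of_upper_bound[of x y y] by (simp add: le_refl)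

lemma same_branch_zero:
  assumes "x \<in> G" "y \<in> G" "\<zero> \<preceq> x" "\<zero> \<preceq> y"
  shows "same_branch x y"
proof -
  have "\<zero> \<in> minimal_elements"
    by (simp add: minimal_elements_def le_def zero_closed mult_zero)
  then show ?thesis
    using assms unfolding same_branch_def branch_def by blast
qed

lemma meet_closed: "\<lbrakk>x \<in> G; y \<in> G\<rbrakk> \<Longrightarrow> x \<sqinter> y \<in> G"
  by (simp add: meet_def mult_closed)

lemma mult_le:
  assumes "x \<in> G" "y \<in> G" "\<zero> \<preceq> y"
  shows "x \<cdot> y \<preceq> x"
  using mult_left_antimono[of \<zero> y x] assms by (simp add: zero_closed mult_zero)

end

section \<open>Infima in a branch\<close>

text \<open>Solid branchwise commutative weak BCC-algebras: the commutative law holds for \<open>x\<close> and \<open>y\<close> in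
  one branch, and so does the exchange law, with \<open>z\<close> arbitrary.\<close>

locale solid_branchwise_commutative_weak_BCC = weak_BCC_algebra +
  assumes solid: solid
    and branchwise_commutative: branchwise_commutative
begin

lemma mult_exchange:
  "\<lbrakk>x \<in> G; y \<in> G; z \<in> G; same_branch x y\<rbrakk> \<Longrightarrow> (x \<cdot> y) \<cdot> z = (x \<cdot> z) \<cdot> y"
  using solid unfolding solid_def by blast

lemma meet_commute:
  "\<lbrakk>x \<in> G; y \<in> G; same_branch x y\<rbrakk> \<Longrightarrow> x \<sqinter> y = y \<sqinter> x"
  using branchwise_commutative unfolding branchwise_commutative_def meet_def by metis

lemma mult_mult_of_le:
  assumes "x \<in> G" "y \<in> G" "x \<preceq> y"
  shows "y \<cdot> (y \<cdot> x) = x"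
  using meet_commute[of x y] same_branch_of_le[of x y] assms
  by (simp add: meet_def le_def mult_zero)

lemma meet_le:
  assumes "x \<in> G" "y \<in> G" "same_branch x y"
  shows "x \<sqinter> y \<preceq> x" "x \<sqinter> y \<preceq> y"
proof -
  have le2: "u \<sqinter> v \<preceq> v" if "u \<in> G" "v \<in> G" "same_branch u v" for u v
    using that mult_le[of v "v \<cdot> u"] zero_le_mult_of_same_branch[OF same_branch_sym]
    by (simp add: meet_def mult_closed)
  show "x \<sqinter> y \<preceq> y"
    using le2 assms by simp
  show "x \<sqinter> y \<preceq> x"
    using le2[of y x] meet_commute assms same_branch_sym by simp
qed

lemma meet_greatest:
  assumes "x \<in> G" "y \<in> G" "z \<in> G" "z \<preceq> x" "z \<preceq> y"
  shows "z \<preceq> x \<sqinter> y"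
proof -
  have "y \<cdot> (y \<cdot> z) \<preceq> y \<cdot> (y \<cdot> x)"
    using assms by (simp add: mult_left_antimono mult_closed)
  then show ?thesis
    using assms by (simp add: mult_mult_of_le meet_def)
qed

lemma mult_meet:
  assumes "x \<in> G" "y \<in> G" "same_branch x y"
  shows "x \<cdot> (y \<sqinter> x) = x \<cdot> y"
proof (rule le_antisym)
  have le: "y \<sqinter> x \<preceq> x" "y \<sqinter> x \<preceq> y"
    using meet_le[of y x] assms same_branch_sym by blast+
  then have "same_branch x (y \<sqinter> x)"
    using same_branch_of_le same_branch_sym meet_closed assms by blast
  then show "x \<cdot> (y \<sqinter> x) \<preceq> x \<cdot> y"
    using mult_exchange[of x "y \<sqinter> x" "x \<cdot> y"] assms mult_self[of "y \<sqinter> x"]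
    by (simp add: le_def meet_def mult_closed)
  show "x \<cdot> y \<preceq> x \<cdot> (y \<sqinter> x)"
    using mult_left_antimono le assms by (simp add: meet_closed)
qed (use assms in \<open>simp_all add: meet_closed mult_closed\<close>)

section \<open>Distributivity of subtraction over meets\<close>

lemma mult_left_cancel:
  assumes "x \<in> G" "y \<in> G" "z \<in> G" "x \<preceq> z" "y \<preceq> z" "z \<cdot> x = z \<cdot> y"
  shows "x = y"
  using assms mult_mult_of_le by metis

text \<open>Right cancellation needs a common upper bound \<open>p\<close>: it is turned into left cancellation
  through \<open>su = (p(ps))u = (pu)(ps)\<close>.\<close>

lemma mult_right_cancel:
  assumes G: "p \<in> G" "s \<in> G" "t \<in> G" "u \<in> G"
    and le: "s \<preceq> p" "t \<preceq> p" "u \<preceq> s" "u \<preceq> t"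
    and eq: "s \<cdot> u = t \<cdot> u"
  shows "s = t"
proof -
  have up: "u \<preceq> p"
    using G le le_trans by blast
  have *: "v \<cdot> u = (p \<cdot> u) \<cdot> (p \<cdot> v)" if "v \<in> G" "v \<preceq> p" for v
  proof -
    have "v \<cdot> u = (p \<cdot> (p \<cdot> v)) \<cdot> u"
      using that G by (simp add: mult_mult_of_le)
    also have "\<dots> = (p \<cdot> u) \<cdot> (p \<cdot> v)"
      using mult_exchange[of p u "p \<cdot> v"] same_branch_of_le[OF _ _ up] same_branch_sym that G
      by (simp add: mult_closed)
    finally show ?thesis .
  qed
  have "p \<cdot> s = p \<cdot> t"
  proof (rule mult_left_cancel)
    show "p \<cdot> s \<preceq> p \<cdot> u" "p \<cdot> t \<preceq> p \<cdot> u"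
      using G le by (simp_all add: mult_left_antimono)
    show "(p \<cdot> u) \<cdot> (p \<cdot> s) = (p \<cdot> u) \<cdot> (p \<cdot> t)"
      using * G le eq by metis
  qed (use G in \<open>simp_all add: mult_closed\<close>)
  then show ?thesis
    using mult_left_cancel G le by blast
qed

text \<open>The element \<open>a((aw)v)\<close> plays the role of a sum of \<open>v\<close> and \<open>w\<close> computed below \<open>a\<close>.\<close>

lemma bounded_sum:
  assumes G: "a \<in> G" "v \<in> G" "w \<in> G"
    and pos: "\<zero> \<preceq> v" and wa: "w \<preceq> a" and v: "v \<preceq> a \<cdot> w"
  defines "s \<equiv> a \<cdot> ((a \<cdot> w) \<cdot> v)"
  shows "s \<preceq> a" "w \<preceq> s" "s \<cdot> w = v"
proof -
  have aw: "same_branch a w"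
    using same_branch_of_le same_branch_sym G wa by blast
  have "\<zero> \<preceq> (a \<cdot> w) \<cdot> v"
    using zero_le_mult_of_same_branch same_branch_of_le same_branch_sym G v mult_closed by meson
  then show "s \<preceq> a"
    unfolding s_def using mult_le G by (simp add: mult_closed)
  have "a \<cdot> (a \<cdot> w) \<preceq> s"
    unfolding s_def using mult_left_antimono mult_le G pos by (simp add: mult_closed)
  then show "w \<preceq> s"
    using G wa by (simp add: mult_mult_of_le)
  show "s \<cdot> w = v"
    unfolding s_def using mult_exchange[of a w "(a \<cdot> w) \<cdot> v"] aw G v
    by (simp add: mult_closed mult_mult_of_le)
qed

text \<open>A lower bound \<open>w\<close> of \<open>ac\<close> and \<open>bc\<close> and the element \<open>v = c \<sqinter> (a \<sqinter> b)\<close> have a sum \<open>s\<close> below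
  \<open>a\<close> and a sum \<open>t\<close> below \<open>b\<close>. Right cancellation of \<open>w\<close> forces \<open>s = t\<close>, so the sum is below
  \<open>a \<sqinter> b\<close>, and then \<open>w\<close> is below the difference of \<open>a \<sqinter> b\<close> and \<open>v\<close>, which equals \<open>(a \<sqinter> b)c\<close>.
  Without the bound \<open>p\<close> the statement fails: let \<open>B(\<zero>)\<close> consist of a chain \<open>\<zero> \<prec> c\<close> and two
  incomparable elements \<open>a, b\<close> covering \<open>c\<close>, with \<open>ac = bc = ab = ba = c\<close> and \<open>w = c\<close>.\<close>

lemma le_meet_mult:
  assumes G: "p \<in> G" "a \<in> G" "b \<in> G" "c \<in> G" "w \<in> G"
    and pos: "\<zero> \<preceq> a" "\<zero> \<preceq> b" "\<zero> \<preceq> c" "\<zero> \<preceq> w"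
    and bound: "a \<preceq> p" "b \<preceq> p"
    and le: "w \<preceq> a \<cdot> c" "w \<preceq> b \<cdot> c"
  shows "w \<preceq> (a \<sqinter> b) \<cdot> c"
proof -
  let ?m = "a \<sqinter> b"
  define v where "v = c \<sqinter> ?m"
  have ab: "same_branch a b"
    using same_branch_zero G pos by blast
  have m: "?m \<in> G" "?m \<preceq> a" "?m \<preceq> b" "\<zero> \<preceq> ?m"
    using G pos ab meet_le meet_greatest meet_closed zero_closed by auto
  have cm: "same_branch c ?m"
    using same_branch_zero G pos m by blast
  have v: "v \<in> G" "v \<preceq> c" "v \<preceq> ?m" "\<zero> \<preceq> v"
    using G pos m cm meet_le meet_greatest meet_closed zero_closed by (auto simp: v_def)
  have key: "w \<preceq> d \<and> v \<preceq> d \<cdot> w"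
    if d: "d \<in> G" "\<zero> \<preceq> d" "?m \<preceq> d" "w \<preceq> d \<cdot> c" for d
  proof
    show "w \<preceq> d"
      using le_trans[of w "d \<cdot> c" d] mult_le d G pos by (simp add: mult_closed)
    have "v \<preceq> c \<sqinter> d"
      using meet_greatest le_trans v d m G by blast
    also have "c \<sqinter> d = d \<cdot> (d \<cdot> c)"
      by (simp add: meet_def)
    finally show "v \<preceq> d \<cdot> w"
      using le_trans[of v "d \<cdot> (d \<cdot> c)" "d \<cdot> w"] mult_left_antimono[of w "d \<cdot> c" d] d G v
      by (simp add: mult_closed)
  qed
  define s where "s = a \<cdot> ((a \<cdot> w) \<cdot> v)"
  define t where "t = b \<cdot> ((b \<cdot> w) \<cdot> v)"
  have s: "s \<in> G" "s \<preceq> a" "w \<preceq> s" "s \<cdot> w = v"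
    using bounded_sum[of a v w] key[of a] G pos m le v by (auto simp: s_def mult_closed)
  have t: "t \<in> G" "t \<preceq> b" "w \<preceq> t" "t \<cdot> w = v"
    using bounded_sum[of b v w] key[of b] G pos m le v by (auto simp: t_def mult_closed)
  have "s = t"
    using mult_right_cancel[of p s t w] s t G bound le_trans by metis
  then have sm: "s \<preceq> ?m"
    using meet_greatest s t G by blast
  have wm: "w \<preceq> ?m"
    using le_trans s sm G m by blast
  have "v \<preceq> ?m \<cdot> w"
    using mult_right_mono[of s ?m w] s sm G m by simp
  then have "?m \<cdot> (?m \<cdot> w) \<preceq> ?m \<cdot> v"
    using mult_left_antimono G m v by (simp add: mult_closed)
  moreover have "?m \<cdot> v = ?m \<cdot> c"
    using mult_meet cm G m same_branch_sym by (simp add: v_def)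
  ultimately show ?thesis
    using mult_mult_of_le wm G m by simp
qed

section \<open>Joins below an element\<close>

lemma zero_le_mult_below:
  "\<lbrakk>p \<in> G; x \<in> G; x \<preceq> p\<rbrakk> \<Longrightarrow> \<zero> \<preceq> p \<cdot> x"
  using zero_le_mult_of_same_branch same_branch_of_le same_branch_sym by blast

lemma complement_meet:
  assumes "p \<in> G" "x \<in> G" "y \<in> G" "x \<preceq> p" "y \<preceq> p"
  defines "r \<equiv> (p \<cdot> x) \<sqinter> (p \<cdot> y)"
  shows "r \<in> G" "r \<preceq> p \<cdot> x" "r \<preceq> p \<cdot> y" "\<zero> \<preceq> r"
  using assms meet_le meet_greatest meet_closed same_branch_zero zero_le_mult_below
  by (auto simp: mult_closed zero_closed)

lemma join_below_closed:
  assumes "p \<in> G" "x \<in> G" "y \<in> G"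
  shows "join_below p x y \<in> G"
  using assms by (simp add: join_below_def meet_closed mult_closed)

lemma join_below_upper:
  assumes "p \<in> G" "x \<in> G" "y \<in> G" "x \<preceq> p" "y \<preceq> p"
  shows "x \<preceq> join_below p x y" "y \<preceq> join_below p x y" "join_below p x y \<preceq> p"
proof -
  note r = complement_meet[OF assms]
  show "x \<preceq> join_below p x y"
    using mult_left_antimono[OF _ _ _ r(2), of p] r assms
    by (simp add: join_below_def mult_closed mult_mult_of_le)
  show "y \<preceq> join_below p x y"
    using mult_left_antimono[OF _ _ _ r(3), of p] r assms
    by (simp add: join_below_def mult_closed mult_mult_of_le)
  show "join_below p x y \<preceq> p"
    using mult_le r assms by (simp add: join_below_def)
qed

lemma join_below_least:
  assumes "p \<in> G" "x \<in> G" "y \<in> G" "z \<in> G" "x \<preceq> z" "y \<preceq> z" "z \<preceq> p"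
  shows "join_below p x y \<preceq> z"
proof -
  have "p \<cdot> z \<preceq> (p \<cdot> x) \<sqinter> (p \<cdot> y)"
    using assms meet_greatest mult_left_antimono by (simp add: mult_closed)
  then have "join_below p x y \<preceq> p \<cdot> (p \<cdot> z)"
    using assms mult_left_antimono meet_closed by (simp add: join_below_def mult_closed)
  then show ?thesis
    using assms by (simp add: mult_mult_of_le)
qed

text \<open>The meet of \<open>px\<close> and \<open>py\<close> is again of the form \<open>pz\<close>, because the elements \<open>pz\<close> with
  \<open>z \<preceq> p\<close> form a down-set of \<open>B(\<zero>)\<close>.\<close>

lemma mult_mult_of_le_mult:
  assumes G: "p \<in> G" "x \<in> G" "u \<in> G" and pos: "\<zero> \<preceq> u" and le: "u \<preceq> p \<cdot> x" "x \<preceq> p"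
  shows "p \<cdot> (p \<cdot> u) = u"
proof (rule le_antisym)
  have pu: "same_branch p (p \<cdot> u)"
    using same_branch_of_le same_branch_sym mult_le G pos mult_closed by meson
  show "p \<cdot> (p \<cdot> u) \<preceq> u"
    using mult_exchange[of p "p \<cdot> u" u] pu G by (simp add: le_def mult_closed mult_self)
  have "u = (p \<cdot> x) \<cdot> ((p \<cdot> x) \<cdot> u)"
    using G le by (simp add: mult_mult_of_le mult_closed)
  also have "(p \<cdot> x) \<cdot> u = (p \<cdot> u) \<cdot> x"
    using mult_exchange[of p x u] same_branch_of_le same_branch_sym G le by blast
  finally have "u = (p \<cdot> x) \<cdot> ((p \<cdot> u) \<cdot> x)" .
  moreover have "(p \<cdot> x) \<cdot> ((p \<cdot> u) \<cdot> x) \<preceq> p \<cdot> (p \<cdot> u)"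
    using BCC[of p x "p \<cdot> u"] G by (simp add: le_def mult_closed)
  ultimately show "u \<preceq> p \<cdot> (p \<cdot> u)"
    by simp
qed (use G in \<open>simp_all add: mult_closed\<close>)

text \<open>The map \<open>x \<mapsto> px\<close> on \<open>A(p)\<close> exchanges the two factors of a product.\<close>

lemma mult_complement:
  assumes "p \<in> G" "x \<in> G" "z \<in> G" "x \<preceq> p" "z \<preceq> p"
  shows "z \<cdot> x = (p \<cdot> x) \<cdot> (p \<cdot> z)"
proof -
  have "z \<cdot> x = (p \<cdot> (p \<cdot> z)) \<cdot> x"
    using assms by (simp add: mult_mult_of_le)
  also have "\<dots> = (p \<cdot> x) \<cdot> (p \<cdot> z)"
    using mult_exchange[of p x "p \<cdot> z"] same_branch_of_le same_branch_sym assms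
    by (simp add: mult_closed)
  finally show ?thesis .
qed

lemma le_mult_join_below:
  assumes G: "p \<in> G" "x \<in> G" "y \<in> G" "z \<in> G" "u \<in> G"
    and le: "x \<preceq> p" "y \<preceq> p" "z \<preceq> p" and pos: "\<zero> \<preceq> u"
    and u: "u \<preceq> z \<cdot> x" "u \<preceq> z \<cdot> y"
  shows "u \<preceq> z \<cdot> join_below p x y"
proof -
  \<comment> \<open>The least element of \<open>A(p)\<close>; it supplies the bound \<open>pa\<close> of \<open>px\<close> and \<open>py\<close>.\<close>
  define a where "a = \<zero> \<cdot> (\<zero> \<cdot> p)"
  have a: "a \<in> G" "a \<preceq> x" "a \<preceq> y"
    using G le zero_zero_mult_le_of_le by (simp_all add: a_def mult_closed zero_closed)
  let ?r = "(p \<cdot> x) \<sqinter> (p \<cdot> y)"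
  note r = complement_meet[OF G(1-3) le(1,2)]
  have "u \<preceq> ?r \<cdot> (p \<cdot> z)"
  proof (rule le_meet_mult[where p = "p \<cdot> a"])
    show "p \<cdot> x \<preceq> p \<cdot> a" "p \<cdot> y \<preceq> p \<cdot> a"
      using a G by (simp_all add: mult_left_antimono)
    show "u \<preceq> (p \<cdot> x) \<cdot> (p \<cdot> z)" "u \<preceq> (p \<cdot> y) \<cdot> (p \<cdot> z)"
      using u mult_complement G le by metis+
  qed (use G a le pos zero_le_mult_below in \<open>auto simp: mult_closed\<close>)
  also have "?r = p \<cdot> join_below p x y"
    using mult_mult_of_le_mult[of p x ?r] r G le by (simp add: join_below_def)
  also have "(p \<cdot> join_below p x y) \<cdot> (p \<cdot> z) = z \<cdot> join_below p x y"
    using mult_complement[of p "join_below p x y" z] join_below_closed join_below_upper G le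
    by simp
  finally show ?thesis .
qed

lemma meet_join_below_le:
  assumes G: "p \<in> G" "x \<in> G" "y \<in> G" "z \<in> G"
    and le: "x \<preceq> p" "y \<preceq> p" "z \<preceq> p"
  shows "z \<sqinter> join_below p x y \<preceq> join_below p (z \<sqinter> x) (z \<sqinter> y)"
proof -
  let ?j = "join_below p x y"
  define s where "s = join_below p (z \<sqinter> x) (z \<sqinter> y)"
  have br: "same_branch z x" "same_branch z y" "same_branch z ?j"
    using same_branch_of_upper_bound G le join_below_closed join_below_upper by auto
  have mx: "z \<sqinter> x \<in> G" "z \<sqinter> x \<preceq> z" "z \<sqinter> x \<preceq> p"
    and my: "z \<sqinter> y \<in> G" "z \<sqinter> y \<preceq> z" "z \<sqinter> y \<preceq> p"
    using meet_le[OF _ _ br(1)] meet_le[OF _ _ br(2)] meet_closed le_trans G le by blast+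
  have s: "s \<in> G" "z \<sqinter> x \<preceq> s" "z \<sqinter> y \<preceq> s" "s \<preceq> z"
    using join_below_closed join_below_upper join_below_least mx my G le by (auto simp: s_def)
  have zs: "z \<cdot> s \<preceq> z \<cdot> w" if w: "w \<in> G" "same_branch z w" "z \<sqinter> w \<preceq> s" for w
    using mult_left_antimono[of "z \<sqinter> w" s z] mult_meet[of z w] meet_commute[of z w] w G s
    by (simp add: meet_closed)
  have "\<zero> \<preceq> z \<cdot> s"
    using zero_le_mult_below s G by blast
  then have "z \<cdot> s \<preceq> z \<cdot> ?j"
    using le_mult_join_below[of p x y z "z \<cdot> s"] zs[of x] zs[of y] br s G le
    by (simp add: mult_closed)
  then have "z \<cdot> (z \<cdot> ?j) \<preceq> z \<cdot> (z \<cdot> s)"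
    using mult_left_antimono s G by (simp add: mult_closed join_below_closed)
  moreover have "z \<cdot> (z \<cdot> ?j) = z \<sqinter> ?j"
    using meet_commute[of z ?j] br G by (simp add: join_below_closed meet_def)
  ultimately show ?thesis
    using mult_mult_of_le[of s z] s G by (simp add: s_def)
qed

section \<open>The lattice of elements below a given element\<close>

lemma distributive_lattice_initial_segment:
  assumes p: "p \<in> G"
  shows "distributive_lattice_on (initial_segment p) (\<sqinter>) (join_below p)"
proof -
  let ?L = "initial_segment p"
  let ?j = "join_below p"
  have L: "x \<in> G" "x \<preceq> p" if "x \<in> ?L" for x
    using that by (simp_all add: initial_segment_def)
  have trans: "x \<preceq> z" if "x \<preceq> y" "y \<preceq> z" "x \<in> ?L" "y \<in> ?L" "z \<in> ?L" for x y z
    using that le_trans L by blast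
  have antisym: "x = y" if "x \<preceq> y" "y \<preceq> x" "x \<in> ?L" "y \<in> ?L" for x y
    using that le_antisym L by blast
  have refl: "x \<preceq> x" if "x \<in> ?L" for x
    using that le_refl L by blast
  have inf_le: "x \<sqinter> y \<preceq> x" "x \<sqinter> y \<preceq> y" if "x \<in> ?L" "y \<in> ?L" for x y
    using that meet_le[of x y] same_branch_of_upper_bound[of x y p] L p by simp_all
  have inf: "x \<sqinter> y \<in> ?L" if "x \<in> ?L" "y \<in> ?L" for x y
  proof -
    have G: "x \<sqinter> y \<in> G"
      using meet_closed L that by simp
    have "x \<sqinter> y \<preceq> p"
      by (rule le_trans[OF G _ p inf_le(1)[OF that]]) (use L that in simp_all)
    then show ?thesis
      using G by (simp add: initial_segment_def)
  qed
  have inf_ge: "z \<preceq> x \<sqinter> y" if "x \<in> ?L" "y \<in> ?L" "z \<in> ?L" "z \<preceq> x" "z \<preceq> y" for x y z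
    using that meet_greatest L by simp
  have sup: "?j x y \<in> ?L" if "x \<in> ?L" "y \<in> ?L" for x y
    using join_below_closed[OF p, of x y] join_below_upper(3)[OF p, of x y] that p
    by (simp add: initial_segment_def)
  have sup_ge: "x \<preceq> ?j x y" "y \<preceq> ?j x y" if "x \<in> ?L" "y \<in> ?L" for x y
    using that join_below_upper L p by simp_all
  have sup_le: "?j x y \<preceq> z" if "x \<in> ?L" "y \<in> ?L" "z \<in> ?L" "x \<preceq> z" "y \<preceq> z" for x y z
    using that join_below_least L p by simp
  have inf_leI: "x \<sqinter> y \<preceq> z" if "x \<preceq> z \<or> y \<preceq> z" "x \<in> ?L" "y \<in> ?L" "z \<in> ?L" for x y z
    using that inf_le[of x y] trans[of "x \<sqinter> y" _ z] inf[of x y] by metis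
  have sup_geI: "z \<preceq> ?j x y" if "z \<preceq> x \<or> z \<preceq> y" "x \<in> ?L" "y \<in> ?L" "z \<in> ?L" for x y z
    using that sup_ge[of x y] trans[of z _ "?j x y"] sup[of x y] by metis
  show ?thesis
  proof
    fix x y assume xy: "x \<in> ?L" "y \<in> ?L"
    show "x \<sqinter> y \<in> ?L" "?j x y \<in> ?L"
      using xy inf sup by blast+
    show "x \<sqinter> y = y \<sqinter> x"
      by (rule antisym) (use xy in \<open>simp_all add: inf inf_le inf_ge\<close>)
    show "?j x y = ?j y x"
      by (rule antisym) (use xy in \<open>simp_all add: sup sup_ge sup_le\<close>)
    show "x \<sqinter> ?j x y = x"
      by (rule antisym) (use xy in \<open>simp_all add: inf sup inf_le inf_ge sup_ge refl\<close>)
    show "?j x (x \<sqinter> y) = x"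
      by (rule antisym) (use xy in \<open>simp_all add: inf sup inf_le sup_ge sup_le refl\<close>)
  next
    fix x y z assume xyz: "x \<in> ?L" "y \<in> ?L" "z \<in> ?L"
    show "(x \<sqinter> y) \<sqinter> z = x \<sqinter> (y \<sqinter> z)"
      by (rule antisym) (use xyz in \<open>simp_all add: inf inf_ge inf_leI refl\<close>)
    show "?j (?j x y) z = ?j x (?j y z)"
      by (rule antisym) (use xyz in \<open>simp_all add: sup sup_le sup_geI refl\<close>)
    show "x \<sqinter> ?j y z = ?j (x \<sqinter> y) (x \<sqinter> z)"
    proof (rule antisym)
      show "x \<sqinter> ?j y z \<preceq> ?j (x \<sqinter> y) (x \<sqinter> z)"
        using meet_join_below_le xyz L p by simp
      show "?j (x \<sqinter> y) (x \<sqinter> z) \<preceq> x \<sqinter> ?j y z"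
        using xyz by (simp add: inf sup inf_ge sup_le inf_leI sup_geI refl)
    qed (use xyz in \<open>simp_all add: inf sup\<close>)
  qed
qed

end

theorem theorem3p5:
  fixes G :: "'a set"
    and mult :: "'a \<Rightarrow> 'a \<Rightarrow> 'a"
    and zero :: 'a
    and p :: 'a
  assumes "weak_BCC_algebra G mult zero"
    and "weak_BCC_algebra.solid G mult zero"
    and "weak_BCC_algebra.branchwise_commutative G mult zero"
    and "p \<in> G"
  shows "distributive_lattice_on (weak_BCC_algebra.initial_segment G mult zero p)
           (weak_BCC_algebra.meet mult) (weak_BCC_algebra.join_below mult p)"
proof -
  interpret solid_branchwise_commutative_weak_BCC G mult zero
    using assms
    by (simp add: solid_branchwise_commutative_weak_BCC_def
        solid_branchwise_commutative_weak_BCC_axioms_def)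
  show ?thesis
    using distributive_lattice_initial_segment assms by blast
qed

end
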